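(* Let $x,y$ be two $2\times 2$ complex matrices such that none of $x$, $y$, $xy$ has an eigenvalue in $]-\infty,0]$, and such that $\log(xy)=\log(x)+\log(y)$, where $\log$ denotes the principal matrix logarithm. Then $xy=yx$.
   Context: For a complex $n\times n$ matrix $x$ with no eigenvalue in the real half-line $]-\infty,0]=\{t\in\mathbb{R}: t\le 0\}$, the principal logarithm $\log(x)$ is the unique complex $n\times n$ matrix $a$ such that $e^a=x$ and every eigenvalue of $a$ lies in the open strip $\{z\in\mathbb{C}: -\pi<\operatorname{Im}(z)<\pi\}$. It exists, and it is a polynomial in $x$. *)

theory Defs
  imports "HOL-Analysis.Analysis"
begin

definition eigenvalue :: "complex ^ 'n ^ 'n \<Rightarrow> complex \<Rightarrow> bool" where
  "eigenvalue A z \<longleftrightarrow> (\<exists>v. v \<noteq> 0 \<and> A *v v = z *s v)"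

(* The library's * and ^ on vectors act componentwise, so powers are built from **. *)
primrec matrix_pow :: "complex ^ 'n ^ 'n \<Rightarrow> nat \<Rightarrow> complex ^ 'n ^ 'n" where
  "matrix_pow A 0 = mat 1"
| "matrix_pow A (Suc k) = A ** matrix_pow A k"

definition matrix_exp :: "complex ^ 'n ^ 'n \<Rightarrow> complex ^ 'n ^ 'n" where
  "matrix_exp A = (\<Sum>k. (1 / fact k) *\<^sub>R matrix_pow A k)"

(* Meaningful when x has no eigenvalue in the closed negative half-line: then such a matrix a
   exists and is unique. *)
definition matrix_log :: "complex ^ 'n ^ 'n \<Rightarrow> complex ^ 'n ^ 'n" where
  "matrix_log x =
    (THE a. matrix_exp a = x \<and> (\<forall>z. eigenvalue a z \<longrightarrow> -pi < Im z \<and> Im z < pi))"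

end

theory Submission
  imports Defs
begin

text \<open>
  Put \<open>a = log x\<close> and \<open>b = log y\<close>. The exponential of a \<open>2 \<times> 2\<close> matrix with eigenvalues \<open>r, s\<close> is an
  affine function of that matrix whose slope is the divided difference of \<open>exp\<close> at \<open>r, s\<close>, and this
  slope is nonzero if the eigenvalues lie in the strip. Hence \<open>exp (a + b) = exp a exp b\<close> can be
  rewritten as \<open>(a - k) (b - l) = m\<close> with scalars \<open>k, l, m\<close>. If \<open>m \<noteq> 0\<close>, then \<open>a\<close> and \<open>b\<close> commute.
  If \<open>m = 0\<close> and neither factor vanishes, then \<open>k\<close> and \<open>l\<close> are eigenvalues of \<open>a\<close> and \<open>b\<close>; writing
  \<open>k'\<close> and \<open>l'\<close> for the other ones, \<open>a + b\<close> has the eigenvalues \<open>k + l'\<close> and \<open>k' + l\<close>, and the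
  divided differences of \<open>exp\<close> at any two of the points \<open>k + l'\<close>, \<open>k + l\<close>, \<open>k' + l\<close> agree. The
  imaginary parts of these points differ by less than \<open>2\<pi>\<close>, which forces the points to coincide;
  then \<open>a - k\<close> and \<open>b - l\<close> are traceless with product \<open>0\<close>, so they commute.

  For the coincidence, translate so that the common divided difference is \<open>1\<close>. If \<open>Im p < Im q\<close>
  and the divided difference at \<open>p, q\<close> is \<open>1\<close>, then a multiple of \<open>2\<pi>\<close> lies strictly between \<open>Im p\<close>
  and \<open>Im q\<close>. Three points with increasing imaginary parts would thus span more than \<open>2\<pi>\<close>.
\<close>


section \<open>Divided differences of the exponential function\<close>

definition exp_dd :: "complex \<Rightarrow> complex \<Rightarrow> complex" where
  "exp_dd u v = (if u = v then exp u else (exp u - exp v) / (u - v))"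

lemma exp_dd_commute: "exp_dd u v = exp_dd v u"
proof (cases "u = v")
  case False
  then show ?thesis
    unfolding exp_dd_def by (simp add: divide_simps) (simp add: algebra_simps)
qed simp

lemma exp_dd_mult: "exp_dd u v * (u - v) = exp u - exp v"
  by (simp add: exp_dd_def)

lemma exp_dd_shift: "exp_dd (w + u) (w + v) = exp w * exp_dd u v"
  by (simp add: exp_dd_def exp_add right_diff_distrib)

lemma exp_dd_nonzero:
  assumes "\<bar>Im u - Im v\<bar> < 2 * pi"
  shows "exp_dd u v \<noteq> 0"
proof
  assume 0: "exp_dd u v = 0"
  then have "u \<noteq> v" and "exp u = exp v"
    by (auto simp: exp_dd_def split: if_splits)
  then obtain n :: int where n: "u = v + of_int (2 * n) * pi * \<i>"
    using exp_eq by blast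
  then have "Im u - Im v = of_int n * (2 * pi)"
    by simp
  with assms have "\<bar>real_of_int n\<bar> * (2 * pi) < 1 * (2 * pi)"
    by (simp add: abs_mult)
  then have "\<bar>real_of_int n\<bar> < 1"
    by (simp only: mult_less_cancel_right) auto
  then have "n = 0" by linarith
  with n \<open>u \<noteq> v\<close> show False by simp
qed

text \<open>The divided difference is the mean of \<open>exp\<close> over the segment from
  \<open>p\<close> to \<open>q\<close>. The mean value theorem for the imaginary part of an
  antiderivative along the segment makes \<open>Im (exp _)\<close> vanish at an interior
  point.\<close>

lemma Im_exp_dd_eq_0_imp:
  assumes "Im p < Im q" and "Im (exp_dd p q) = 0"
  obtains y where "Im p < y" "y < Im q" "sin y = 0"
proof -
  define d where "d = q - p"
  have d: "d \<noteq> 0" "Im d > 0" using assms by (auto simp: d_def)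
  define f where "f t = Im (exp (p + of_real t * d) / d)" for t :: real
  have "(f has_real_derivative Im (exp (p + of_real t * d))) (at t)" for t
  proof -
    have "((\<lambda>t. exp (p + of_real t * d) / d) has_vector_derivative exp (p + of_real t * d)) (at t)"
      by (rule has_vector_derivative_real_field) (use d in \<open>auto intro!: derivative_eq_intros\<close>)
    from bounded_linear.has_vector_derivative[OF bounded_linear_Im this] show ?thesis
      by (simp add: f_def[abs_def] has_real_derivative_iff_has_vector_derivative)
  qed
  with MVT2[of 0 1 f "\<lambda>t. Im (exp (p + of_real t * d))"]
  obtain t where t: "0 < t" "t < 1" "f 1 - f 0 = Im (exp (p + of_real t * d))"
    by auto
  have "f 1 - f 0 = Im (exp_dd q p)"
    using d by (auto simp: f_def d_def exp_dd_def diff_divide_distrib)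
  then have "Im (exp (p + of_real t * d)) = 0"
    using t assms(2) by (simp add: exp_dd_commute)
  then have "sin (Im p + t * Im d) = 0"
    by (simp add: Im_exp)
  moreover have "t * Im d < 1 * Im d" using t d by (intro mult_strict_right_mono)
  ultimately show ?thesis
    using that[of "Im p + t * Im d"] t d by (auto simp: d_def)
qed

text \<open>Sine has a zero \<open>y = k * pi\<close> in between. Were there no even multiple of pi,
  \<open>k\<close> would be odd and both ends would lie within pi of \<open>y\<close>, so sin (Im p)
  >= 0 >= sin (Im q). Then Im (exp p - exp q) >= 0, although it equals Im p - Im q < 0.\<close>

lemma exp_dd_eq_1_Im:
  assumes less: "Im p < Im q" and dd: "exp_dd p q = 1"
  obtains m :: int where "Im p < 2 * pi * m" "2 * pi * m < Im q"
proof (rule ccontr)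
  assume "\<not> thesis"
  then have no: "\<not> (Im p < 2 * pi * of_int m \<and> 2 * pi * of_int m < Im q)" for m :: int
    using that by blast
  obtain y where y: "Im p < y" "y < Im q" "sin y = 0"
    using Im_exp_dd_eq_0_imp[OF less] dd by auto
  then obtain k :: int where k: "y = of_int k * pi"
    using sin_zero_iff_int2 by blast
  have "odd k"
  proof
    assume "even k"
    then obtain m where "k = 2 * m" by (elim evenE)
    with k y no[of m] show False by (simp add: mult_ac)
  qed
  then obtain m where m: "k = 2 * m + 1" by (elim oddE)
  have ym: "y = 2 * pi * m + pi" using k m by (simp add: algebra_simps)
  have P: "2 * pi * m \<le> Im p" using no[of m] y ym pi_gt_zero by linarith
  have Q: "Im q \<le> 2 * pi * m + 2 * pi"
    using no[of "m + 1"] y ym pi_gt_zero by (simp add: distrib_left)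
  have "sin (Im p - 2 * pi * m) \<ge> 0"
    using P y ym by (intro sin_ge_zero) auto
  then have p: "sin (Im p) \<ge> 0"
    by (simp add: sin_diff)
  have "sin (Im q - 2 * pi * m - pi) \<ge> 0"
    using Q y ym by (intro sin_ge_zero) auto
  then have q: "sin (Im q) \<le> 0"
    by (simp add: sin_diff)
  have "exp p - exp q = p - q"
    using exp_dd_mult[of p q] dd by simp
  then have "exp (Re p) * sin (Im p) - exp (Re q) * sin (Im q) = Im p - Im q"
    by (metis Im_exp minus_complex.simps(2))
  moreover have "exp (Re p) * sin (Im p) \<ge> 0" "exp (Re q) * sin (Im q) \<le> 0"
    using p q by (auto simp: mult_nonneg_nonpos)
  ultimately show False using less by linarith
qed

text \<open>The imaginary part of exp q - exp p = q - p gives sin = 0, the real part gives cos > 0,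
  so cos = 1. The real exponential then has mean slope 1 between the real parts, which puts 0
  strictly between them.\<close>

lemma exp_dd_eq_1_Re:
  assumes "Im p = Im q" "Re p < Re q" and dd: "exp_dd p q = 1"
  obtains m :: int where "Im p = 2 * pi * m" "Re p < 0" "0 < Re q"
proof -
  have eq: "exp q - exp p = q - p"
    using exp_dd_mult[of q p] dd by (simp add: exp_dd_commute)
  have "Im (exp q - exp p) = 0" using assms by (simp add: eq)
  then have "(exp (Re q) - exp (Re p)) * sin (Im p) = 0"
    using assms by (simp add: Im_exp algebra_simps)
  then have s: "sin (Im p) = 0" using assms by simp
  have R: "(exp (Re q) - exp (Re p)) * cos (Im p) = Re q - Re p"
    using arg_cong[OF eq, of Re] assms by (simp add: Re_exp algebra_simps)
  have "cos (Im p) > 0"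
    using R assms by (smt (verit) exp_less_mono zero_less_mult_pos)
  then have c: "cos (Im p) = 1"
    using s sin_cos_squared_add[of "Im p"] by (simp add: power2_eq_1_iff)
  then obtain m :: int where m: "Im p = of_int m * (2 * pi)"
    using cos_one_2pi_int by (metis mult.commute mult.assoc)
  have R: "exp (Re q) - exp (Re p) = Re q - Re p" using R c by simp
  obtain t where t: "Re p < t" "t < Re q" "exp (Re q) - exp (Re p) = (Re q - Re p) * exp t"
    using MVT2[of "Re p" "Re q" exp exp] assms by (auto intro: DERIV_exp)
  then have "exp t = 1" using R assms by simp
  then have "t = 0" by simp
  with t m that[of m] show ?thesis by (simp add: mult_ac)
qed

text \<open>A total order, so that three points can be sorted; real parts decide between points of
  equal height.\<close>

definition lexle :: "complex \<Rightarrow> complex \<Rightarrow> bool" where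
  "lexle p q \<longleftrightarrow> Im p < Im q \<or> Im p = Im q \<and> Re p \<le> Re q"

lemma exp_dd_eq_1_cases:
  assumes "lexle p q" "exp_dd p q = 1"
  obtains m :: int where "Im p < 2 * pi * m" "2 * pi * m < Im q"
    | m :: int where "Im p = 2 * pi * m" "Im q = 2 * pi * m" "Re p < 0" "0 < Re q"
    | m :: int where "Im p = 2 * pi * m" "Re p = 0" "q = p"
proof -
  consider "Im p < Im q" | "Im p = Im q" "Re p < Re q" | "p = q"
    using assms(1) by (force simp: lexle_def complex_eq_iff)
  then show ?thesis
  proof cases
    case 1
    then show ?thesis using exp_dd_eq_1_Im[OF 1 assms(2)] that(1) by blast
  next
    case 2
    then show ?thesis using exp_dd_eq_1_Re[OF 2 assms(2)] that(2) by metis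
  next
    case 3
    then have "exp p = exp 0" using assms(2) by (simp add: exp_dd_def)
    then obtain m :: int where "p = 0 + of_int (2 * m) * pi * \<i>"
      using exp_eq by blast
    then show ?thesis using that(3)[of m] 3 by simp
  qed
qed

text \<open>Each adjacent pair supplies a multiple of 2 pi in its range of imaginary parts. By
  \<open>sep\<close> the two multiples cannot differ, and if they agree, the sign of
  \<open>Re q\<close> rules out everything but coinciding points.\<close>

lemma exp_dd_eq_1_sorted:
  assumes "lexle p q" "lexle q r" "exp_dd p q = 1" "exp_dd q r = 1" "Im r < Im p + 2 * pi"
  shows "p = q \<and> q = r"
proof -
  have sep: False if "Im p \<le> 2 * pi * of_int m" "2 * pi * of_int m < 2 * pi * of_int n"
    "2 * pi * of_int n \<le> Im r" for m n :: int
  proof -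
    have "m < n" using that(2) by simp
    then have "real_of_int m + 1 \<le> real_of_int n" by linarith
    then have "2 * pi * (real_of_int m + 1) \<le> 2 * pi * real_of_int n"
      by (intro mult_left_mono) auto
    then show False using that assms(5) by (simp add: distrib_left)
  qed
  show ?thesis
    using assms(1,3)
  proof (cases rule: exp_dd_eq_1_cases)
    case (1 m)
    note pq = this
    from assms(2,4) show ?thesis
    proof (cases rule: exp_dd_eq_1_cases)
      case (1 n)
      with pq sep[of m n] show ?thesis by (smt (verit))
    next
      case (2 n)
      with pq sep[of m n] show ?thesis by (smt (verit))
    next
      case (3 n)
      with pq sep[of m n] show ?thesis by (smt (verit))
    qed
  next
    case (2 m)
    note pq = this
    from assms(2,4) show ?thesis
    proof (cases rule: exp_dd_eq_1_cases)
      case (1 n)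
      with pq sep[of m n] show ?thesis by (smt (verit))
    next
      case (2 n)
      with pq sep[of m n] show ?thesis by (smt (verit))
    next
      case (3 n)
      with pq sep[of m n] show ?thesis by (smt (verit))
    qed
  next
    case (3 m)
    note pq = this
    from assms(2,4) show ?thesis
    proof (cases rule: exp_dd_eq_1_cases)
      case (1 n)
      with pq sep[of m n] show ?thesis by (smt (verit))
    next
      case (2 n)
      with pq sep[of m n] show ?thesis by (smt (verit))
    next
      case (3 n)
      with pq sep[of m n] show ?thesis by (smt (verit))
    qed
  qed
qed

lemma exp_dd_all_equal:
  assumes "exp_dd p q = B" "exp_dd q r = B" "exp_dd p r = B"
    and "\<bar>Im p - Im q\<bar> < 2 * pi" "\<bar>Im q - Im r\<bar> < 2 * pi" "\<bar>Im p - Im r\<bar> < 2 * pi"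
  shows "p = q \<and> q = r"
proof -
  have "B \<noteq> 0" using exp_dd_nonzero assms by metis
  define w where "w = - Ln B"
  have one: "exp w * B = 1" using \<open>B \<noteq> 0\<close> by (simp add: w_def exp_minus)
  define p' q' r' where "p' = w + p" and "q' = w + q" and "r' = w + r"
  note defs = p'_def q'_def r'_def
  have dd: "exp_dd p' q' = 1" "exp_dd q' r' = 1" "exp_dd p' r' = 1"
    using one assms by (simp_all add: defs exp_dd_shift)
  note dd = dd dd[unfolded exp_dd_commute[of p'] exp_dd_commute[of q' r']]
  have total: "lexle a b \<or> lexle b a" for a b
    by (auto simp: lexle_def)
  \<comment> \<open>Any two of the points may be adjacent after sorting, so all six orders are tried
    with all three divided differences.\<close>
  have "p' = q' \<and> q' = r'"
    using total[of p' q'] total[of q' r'] total[of p' r']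
      exp_dd_eq_1_sorted[of p' q' r'] exp_dd_eq_1_sorted[of p' r' q']
      exp_dd_eq_1_sorted[of q' p' r'] exp_dd_eq_1_sorted[of q' r' p']
      exp_dd_eq_1_sorted[of r' p' q'] exp_dd_eq_1_sorted[of r' q' p']
      dd assms(4-6) by (auto simp: defs abs_less_iff)
  then show ?thesis by (simp add: defs)
qed

section \<open>Eigenvalues of 2 x 2 matrices, counted with multiplicity\<close>

definition char_roots :: "complex ^ 2 ^ 2 \<Rightarrow> complex \<Rightarrow> complex \<Rightarrow> bool" where
  "char_roots A r s \<longleftrightarrow> trace A = r + s \<and> det A = r * s"

lemma trace_2: "trace (A :: 'a::comm_semiring_1 ^ 2 ^ 2) = A$1$1 + A$2$2"
  by (simp add: trace_def sum_2)

lemmas mat2_simps = vec_eq_iff forall_2 matrix_matrix_mult_def sum_2 mat_def trace_2 det_2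

lemma mat_component: "mat c $ i $ j = (if i = j then c else 0)"
  by (simp add: mat_def)

lemma mat_mult_component: "(mat c ** A) $ i $ j = c * A $ i $ j"
  for A :: "'a::comm_semiring_1 ^ 'n ^ 'n"
  by (simp add: matrix_matrix_mult_def mat_def if_distrib if_distribR sum.delta cong: if_cong)

lemma char_roots_exist:
  obtains r s where "char_roots A r s"
proof
  define w where "w = csqrt ((trace A)\<^sup>2 - 4 * det A)"
  have "w\<^sup>2 = (trace A)\<^sup>2 - 4 * det A" by (simp add: w_def)
  then show "char_roots A ((trace A + w) / 2) ((trace A - w) / 2)"
    by (simp add: char_roots_def field_simps power2_eq_square)
qed

lemma char_roots_commute: "char_roots A r s \<longleftrightarrow> char_roots A s r"
  by (simp add: char_roots_def algebra_simps)

lemma char_roots_unique: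
  assumes "char_roots A r s" "char_roots A r' s'"
  shows "r' = r \<and> s' = s \<or> r' = s \<and> s' = r"
proof -
  have sum: "r' + s' = r + s" and "r' * s' = r * s"
    using assms by (auto simp: char_roots_def)
  then have "(r' - r) * (r' - s) = 0" by algebra
  with sum show ?thesis by auto
qed

lemma det_diff_mat:
  assumes "char_roots A r s"
  shows "det (A - mat z) = (z - r) * (z - s)"
proof -
  have "det (A - mat z) = z\<^sup>2 - trace A * z + det A"
    by (simp add: mat2_simps algebra_simps power2_eq_square)
  then show ?thesis
    using assms by (simp add: char_roots_def algebra_simps power2_eq_square)
qed

lemma eigenvalue_iff_det: "eigenvalue A z \<longleftrightarrow> det (A - mat z) = 0"
proof -
  have "A *v v = z *s v \<longleftrightarrow> (A - mat z) *v v = 0" for v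
  proof -
    have "mat z *v v = z *s v"
      by (simp add: vec_eq_iff matrix_vector_mult_def mat_def if_distrib if_distribR cong: if_cong)
    then show ?thesis by (simp add: matrix_vector_mult_diff_rdistrib)
  qed
  then show ?thesis
    unfolding eigenvalue_def
    using matrix_left_invertible_ker[of "A - mat z"] invertible_det_nz[of "A - mat z"]
      invertible_left_inverse[of "A - mat z"] by blast
qed

lemma eigenvalue_iff:
  assumes "char_roots A r s"
  shows "eigenvalue A z \<longleftrightarrow> z = r \<or> z = s"
  by (simp add: eigenvalue_iff_det det_diff_mat[OF assms])

text \<open>This is (A - s) (A - r) = 0, arranged so that \<open>A\<close> acts on
  \<open>A - mat r\<close> as the scalar \<open>s\<close>.\<close>

lemma cayley_hamilton_2:
  assumes "char_roots A r s"
  shows "A ** (A - mat r) = mat s ** (A - mat r)"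
proof -
  have "A$1$1 + A$2$2 = r + s" "A$1$1 * A$2$2 - A$1$2 * A$2$1 = r * s"
    using assms by (auto simp: char_roots_def trace_2 det_2)
  then show ?thesis
    by (simp add: mat2_simps) algebra
qed

section \<open>Powers and exponential of a 2 x 2 matrix by interpolation\<close>

definition power_dd :: "complex \<Rightarrow> complex \<Rightarrow> nat \<Rightarrow> complex" where
  "power_dd r s k = (if r = s then of_nat k * r ^ (k - 1) else (r ^ k - s ^ k) / (r - s))"

lemma power_dd_0: "power_dd r s 0 = 0"
  by (simp add: power_dd_def)

lemma power_dd_Suc: "power_dd r s (Suc k) = r ^ k + s * power_dd r s k"
proof (cases "r = s")
  case True
  then show ?thesis by (cases k) (simp_all add: power_dd_def algebra_simps)
next
  case False
  then show ?thesis by (simp add: power_dd_def divide_simps) (simp add: algebra_simps)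
qed

lemma power_dd_sums: "(\<lambda>k. power_dd r s k / fact k) sums exp_dd r s"
proof -
  have e: "(\<lambda>k. z ^ k / fact k) sums exp z" for z :: complex
    using exp_converges[of z] by (simp add: scaleR_conv_of_real field_simps)
  show ?thesis
  proof (cases "r = s")
    case True
    \<comment> \<open>For a double root the term at 0 vanishes; dropping it shifts the series onto
      that of \<open>exp r\<close>.\<close>
    have "(\<lambda>k. power_dd r s (Suc k) / fact (Suc k)) = (\<lambda>k. r ^ k / fact k)"
      using True by (auto simp: power_dd_def fun_eq_iff divide_simps simp del: of_nat_Suc)
    then have "(\<lambda>k. power_dd r s (Suc k) / fact (Suc k)) sums exp r"
      using e by simp
    then show ?thesis
      using True by (subst (asm) sums_Suc_iff) (simp add: power_dd_0 exp_dd_def)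
  next
    case False
    have "(\<lambda>k. (r ^ k / fact k - s ^ k / fact k) / (r - s)) sums ((exp r - exp s) / (r - s))"
      by (intro sums_divide sums_diff e)
    then show ?thesis
      using False by (simp add: power_dd_def exp_dd_def diff_divide_distrib mult.commute)
  qed
qed

text \<open>Newton interpolation of the k-th power at \<open>r\<close>, \<open>s\<close>, with
  \<open>power_dd\<close> as its divided difference; it also covers r = s.\<close>

lemma matrix_pow_2:
  assumes "char_roots A r s"
  shows "matrix_pow A k = mat (r ^ k) + mat (power_dd r s k) ** (A - mat r)"
proof (induction k)
  case 0
  show ?case by (simp add: power_dd_0 mat2_simps)
next
  case (Suc k)
  define g where "g = power_dd r s k"
  have CH: "(A ** (A - mat r)) $ i $ j = (mat s ** (A - mat r)) $ i $ j" for i j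
    by (simp add: cayley_hamilton_2[OF assms])
  have "matrix_pow A (Suc k) = A ** (mat (r ^ k) + mat g ** (A - mat r))"
    by (simp add: Suc g_def)
  also have "\<dots> = mat (r ^ Suc k) + mat (r ^ k + s * g) ** (A - mat r)"
    using CH[of 1 1] CH[of 1 2] CH[of 2 1] CH[of 2 2]
    by (simp add: mat2_simps) algebra
  finally show ?case by (simp add: power_dd_Suc g_def)
qed

lemma matrix_exp_2:
  assumes "char_roots A r s"
  shows "matrix_exp A = mat (exp r) + mat (exp_dd r s) ** (A - mat r)"
proof -
  have e: "(\<lambda>k. r ^ k / fact k) sums exp r"
    using exp_converges[of r] by (simp add: scaleR_conv_of_real field_simps)
  have comp: "(\<lambda>k. ((1 / fact k) *\<^sub>R matrix_pow A k) $ i $ j) sums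
      (mat (exp r) + mat (exp_dd r s) ** (A - mat r)) $ i $ j" for i j
  proof -
    define \<delta> :: complex where "\<delta> = (if i = j then 1 else 0)"
    have "(\<lambda>k. r ^ k / fact k * \<delta> + power_dd r s k / fact k * (A - mat r) $ i $ j) sums
        (exp r * \<delta> + exp_dd r s * (A - mat r) $ i $ j)"
      by (intro sums_add sums_mult2 e power_dd_sums)
    moreover have "((1 / fact k) *\<^sub>R matrix_pow A k) $ i $ j =
        r ^ k / fact k * \<delta> + power_dd r s k / fact k * (A - mat r) $ i $ j" for k
      by (simp add: matrix_pow_2[OF assms] mat_mult_component mat_component \<delta>_def)
        (simp add: scaleR_conv_of_real field_simps)
    ultimately show ?thesis
      by (cases "i = j") (simp_all add: mat_mult_component mat_component \<delta>_def)
  qed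
  have "(\<lambda>k. (1 / fact k) *\<^sub>R matrix_pow A k) sums
      (mat (exp r) + mat (exp_dd r s) ** (A - mat r))"
    unfolding sums_def
    by (intro vec_tendstoI) (use comp in \<open>simp add: sums_def\<close>)
  then show ?thesis
    unfolding matrix_exp_def by (rule sums_unique[symmetric])
qed

section \<open>Existence and uniqueness of the principal logarithm\<close>

definition in_strip :: "complex ^ 2 ^ 2 \<Rightarrow> bool" where
  "in_strip a \<longleftrightarrow> (\<forall>z. eigenvalue a z \<longrightarrow> - pi < Im z \<and> Im z < pi)"

lemma in_strip_iff:
  assumes "char_roots a r s"
  shows "in_strip a \<longleftrightarrow> \<bar>Im r\<bar> < pi \<and> \<bar>Im s\<bar> < pi"
  unfolding in_strip_def eigenvalue_iff[OF assms] by auto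

lemma char_roots_affine:
  assumes "char_roots A r s"
  shows "char_roots (mat u + mat d ** (A - mat r)) u (u + d * (s - r))"
proof -
  have "A$1$1 + A$2$2 = r + s" "A$1$1 * A$2$2 - A$1$2 * A$2$1 = r * s"
    using assms by (auto simp: char_roots_def trace_2 det_2)
  then show ?thesis
    unfolding char_roots_def by (simp add: mat2_simps) algebra
qed

lemma matrix_log_exists:
  assumes "\<And>z. eigenvalue x z \<Longrightarrow> z \<notin> \<real>\<^sub>\<le>\<^sub>0"
  obtains a where "matrix_exp a = x" "in_strip a"
proof -
  obtain z w where zw: "char_roots x z w" using char_roots_exist .
  then have n: "z \<notin> \<real>\<^sub>\<le>\<^sub>0" "w \<notin> \<real>\<^sub>\<le>\<^sub>0"
    using assms eigenvalue_iff[OF zw] by auto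
  then have nz: "z \<noteq> 0" "w \<noteq> 0" by auto
  define r s where "r = Ln z" and "s = Ln w"
  have im: "\<bar>Im r\<bar> < pi" "\<bar>Im s\<bar> < pi"
    using n nz mpi_less_Im_Ln[of z] mpi_less_Im_Ln[of w] Im_Ln_less_pi[of z] Im_Ln_less_pi[of w]
    by (auto simp: r_def s_def abs_less_iff)
  define d where "d = exp_dd r s"
  have d: "d \<noteq> 0" unfolding d_def using im by (intro exp_dd_nonzero) auto
  \<comment> \<open>Inverts the affine formula for the exponential: \<open>1 / d\<close> is the
    divided difference of \<open>Ln\<close> at \<open>z\<close>, \<open>w\<close>.\<close>
  define a where "a = mat r + mat (1 / d) ** (x - mat z)"
  have "d * (r - s) = z - w"
    using exp_dd_mult[of r s] nz by (simp add: d_def r_def s_def)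
  then have "r + 1 / d * (w - z) = s" using d by (simp add: field_simps)
  then have a: "char_roots a r s"
    using char_roots_affine[OF zw, of r "1 / d"] by (simp add: a_def)
  show ?thesis
  proof
    show "in_strip a" using im by (simp add: in_strip_iff[OF a])
    have "matrix_exp a = mat z + mat d ** (a - mat r)"
      using matrix_exp_2[OF a] nz by (simp add: d_def r_def)
    also have "\<dots> = x"
      using d by (simp add: a_def mat_mult_component vec_eq_iff)
    finally show "matrix_exp a = x" .
  qed
qed

lemma char_roots_matrix_exp:
  assumes "char_roots a r s"
  shows "char_roots (matrix_exp a) (exp r) (exp s)"
proof -
  have "exp r + exp_dd r s * (s - r) = exp s"
    using exp_dd_mult[of r s] by (simp add: algebra_simps)
  then show ?thesis
    using char_roots_affine[OF assms, of "exp r" "exp_dd r s"] by (simp add: matrix_exp_2[OF assms])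
qed

text \<open>\<open>exp\<close> is injective on the strip, so both matrices have the same
  eigenvalues. Their exponentials are then the same affine function of them, with nonzero
  slope.\<close>

lemma matrix_exp_inj_in_strip:
  assumes "matrix_exp a = matrix_exp b" "in_strip a" "in_strip b"
  shows "a = b"
proof -
  obtain r s where a: "char_roots a r s" using char_roots_exist .
  obtain r' s' where b: "char_roots b r' s'"
    and "exp r' = exp r" "exp s' = exp s"
  proof -
    obtain u v where b: "char_roots b u v" using char_roots_exist .
    have "exp u = exp r \<and> exp v = exp s \<or> exp u = exp s \<and> exp v = exp r"
      using char_roots_unique[OF char_roots_matrix_exp[OF a]] char_roots_matrix_exp[OF b] assms(1)
      by simp
    then show ?thesis
      using that[of u v] that[of v u] b char_roots_commute by auto
  qed
  moreover have im: "\<bar>Im r\<bar> < pi" "\<bar>Im s\<bar> < pi" "\<bar>Im r'\<bar> < pi" "\<bar>Im s'\<bar> < pi"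
    using assms in_strip_iff[OF a] in_strip_iff[OF b] by auto
  ultimately have "r' = r" "s' = s"
    by (metis Ln_exp abs_less_iff less_imp_le minus_less_iff)+
  with b have b: "char_roots b r s" by simp
  have "exp_dd r s \<noteq> 0" using im by (intro exp_dd_nonzero) auto
  moreover have "mat (exp_dd r s) ** (a - mat r) = mat (exp_dd r s) ** (b - mat r)"
    using assms(1) by (simp add: matrix_exp_2[OF a] matrix_exp_2[OF b])
  ultimately show ?thesis
    by (simp add: vec_eq_iff mat_mult_component)
qed

lemma matrix_log:
  assumes "\<And>z. eigenvalue x z \<Longrightarrow> z \<notin> \<real>\<^sub>\<le>\<^sub>0"
  shows "matrix_exp (matrix_log x) = x" "in_strip (matrix_log x)"
proof -
  have "\<exists>!a. matrix_exp a = x \<and> in_strip a"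
    using matrix_log_exists[OF assms] matrix_exp_inj_in_strip by metis
  from theI'[OF this] show "matrix_exp (matrix_log x) = x" "in_strip (matrix_log x)"
    unfolding matrix_log_def in_strip_def by blast+
qed

section \<open>Commutation from the product of two shifted matrices\<close>

lemma mat_diff_commute_iff:
  "(a - mat k) ** (b - mat l) = (b - mat l) ** (a - mat k) \<longleftrightarrow> a ** b = b ** a"
  for a b :: "complex ^ 2 ^ 2"
  by (simp add: mat2_simps algebra_simps)

lemma commute_if_mult_eq_mat:
  fixes P Q :: "complex ^ 2 ^ 2"
  assumes "P ** Q = mat k" "k \<noteq> 0"
  shows "Q ** P = mat k"
proof -
  have "(mat (1 / k) ** P) ** Q = mat 1"
    using assms by (simp add: matrix_mul_assoc[symmetric]) (simp add: mat2_simps)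
  then have "Q ** (mat (1 / k) ** P) = mat 1"
    using matrix_left_right_inverse by blast
  then show ?thesis
    using assms(2) by (simp add: mat2_simps field_simps)
qed

lemma det_eq_0_if_mult_eq_0:
  fixes P Q :: "complex ^ 2 ^ 2"
  assumes "P ** Q = 0" "P \<noteq> 0" "Q \<noteq> 0"
  shows "det P = 0" "det Q = 0"
proof -
  show "det P = 0"
  proof (rule ccontr)
    assume "det P \<noteq> 0"
    then obtain P' where "P' ** P = mat 1"
      using invertible_det_nz invertible_left_inverse by blast
    then have "Q = P' ** (P ** Q)" by (simp add: matrix_mul_assoc)
    with assms show False by (simp add: mat2_simps)
  qed
  show "det Q = 0"
  proof (rule ccontr)
    assume "det Q \<noteq> 0"
    then obtain Q' where "Q ** Q' = mat 1"
      using invertible_det_nz invertible_right_inverse by blast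
    then have "P = (P ** Q) ** Q'" by (simp add: matrix_mul_assoc[symmetric])
    with assms show False by (simp add: mat2_simps)
  qed
qed

text \<open>The image of \<open>b - mat s2\<close> lies in the kernel of \<open>a - mat r1\<close>.
  If it is nonzero, \<open>a\<close> acts on it as \<open>r1\<close> and \<open>b\<close> as
  \<open>s1\<close>, which explains the pairing; the trace gives the other root.\<close>

lemma char_roots_add:
  fixes a b :: "complex ^ 2 ^ 2"
  assumes "(a - mat r1) ** (b - mat s2) = 0" "char_roots a r1 r2" "char_roots b s1 s2"
  shows "char_roots (a + b) (r1 + s1) (r2 + s2)"
  using assms unfolding char_roots_def by (simp add: mat2_simps) algebra

text \<open>A traceless 2 x 2 matrix is minus its adjugate, and adjugates reverse products, so Q P =
  adj (P Q) = 0.\<close>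

lemma commute_if_mult_eq_0:
  fixes P Q :: "complex ^ 2 ^ 2"
  assumes "P ** Q = 0" "trace P = 0" "trace Q = 0"
  shows "Q ** P = 0"
  using assms by (simp add: mat2_simps) algebra

lemma matrix_exp_2_alt:
  assumes "char_roots A r s"
  shows "matrix_exp A = mat (exp r - exp_dd r s * r) + mat (exp_dd r s) ** A"
  unfolding matrix_exp_2[OF assms] by (simp add: mat2_simps algebra_simps)

text \<open>The exponentials are affine in their arguments, so \<open>exp (a + b) = exp a exp b\<close> expresses
  \<open>a b\<close> as a linear combination of \<open>1\<close>, \<open>a\<close> and \<open>b\<close>.\<close>
lemma affine_product_factor:
  fixes a b :: "complex ^ 2 ^ 2"
  assumes eq: "mat \<gamma>0 + mat \<gamma> ** (a + b) = (mat \<alpha>0 + mat \<alpha> ** a) ** (mat \<beta>0 + mat \<beta> ** b)"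
    and nz: "\<alpha> \<noteq> 0" "\<beta> \<noteq> 0"
  obtains k l m where "(a - mat k) ** (b - mat l) = mat m"
    "\<gamma> = \<beta> * (\<alpha>0 + \<alpha> * k)" "\<gamma> = \<alpha> * (\<beta>0 + \<beta> * l)"
proof
  \<comment> \<open>Found by comparing the coefficients of \<open>b\<close> and \<open>a\<close>
    with those in (a - k) (b - l); \<open>m\<close> collects the scalars.\<close>
  define k l where "k = (\<gamma> - \<alpha>0 * \<beta>) / (\<alpha> * \<beta>)" and "l = (\<gamma> - \<alpha> * \<beta>0) / (\<alpha> * \<beta>)"
  show k: "\<gamma> = \<beta> * (\<alpha>0 + \<alpha> * k)" and l: "\<gamma> = \<alpha> * (\<beta>0 + \<beta> * l)"
    using nz by (simp_all add: k_def l_def field_simps)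
  define m where "m = (\<gamma>0 - \<alpha>0 * \<beta>0) / (\<alpha> * \<beta>) + k * l"
  have m: "\<alpha> * \<beta> * m = \<gamma>0 - \<alpha>0 * \<beta>0 + \<alpha> * \<beta> * k * l"
    using nz by (simp add: m_def field_simps)
  have "\<alpha> * \<beta> * ((a - mat k) ** (b - mat l)) $ i $ j = \<alpha> * \<beta> * mat m $ i $ j" for i j
  proof -
    have "\<forall>i j. \<alpha> * \<beta> * ((a - mat k) ** (b - mat l)) $ i $ j = \<alpha> * \<beta> * mat m $ i $ j"
      using eq k l m by (simp add: mat2_simps) algebra
    then show ?thesis by blast
  qed
  then show "(a - mat k) ** (b - mat l) = mat m"
    using nz by (simp add: vec_eq_iff)
qed

text \<open>Puts the eigenvalue \<open>k\<close> first; the last equation says that the interpolant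
  of \<open>exp\<close> is exact at \<open>k\<close>.\<close>

lemma char_roots_with_root:
  assumes "char_roots A r s" "det (A - mat k) = 0"
  obtains t where "char_roots A k t" "exp_dd k t = exp_dd r s"
    "exp r - exp_dd r s * r + exp_dd r s * k = exp k"
proof -
  have "k = r \<or> k = s" using assms det_diff_mat[OF assms(1)] by auto
  then show ?thesis
  proof
    assume "k = r"
    then show ?thesis using that[of s] assms by simp
  next
    assume "k = s"
    then show ?thesis
      using that[of r] assms exp_dd_mult[of r s] char_roots_commute exp_dd_commute[of s r]
      by (simp add: algebra_simps)
  qed
qed

lemma matrix_exp_add_imp_commute:
  fixes a b :: "complex ^ 2 ^ 2"
  assumes eq: "matrix_exp (a + b) = matrix_exp a ** matrix_exp b"
    and strip: "in_strip a" "in_strip b" "in_strip (a + b)"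
  shows "a ** b = b ** a"
proof -
  obtain r s where a: "char_roots a r s" using char_roots_exist .
  obtain u v where b: "char_roots b u v" using char_roots_exist .
  obtain e f where c: "char_roots (a + b) e f" using char_roots_exist .
  have nz: "exp_dd r s \<noteq> 0" "exp_dd u v \<noteq> 0"
    using strip in_strip_iff[OF a] in_strip_iff[OF b] by (auto intro!: exp_dd_nonzero)
  from eq obtain k l m where PQ: "(a - mat k) ** (b - mat l) = mat m"
    and k: "exp_dd e f = exp_dd u v * (exp r - exp_dd r s * r + exp_dd r s * k)"
    and l: "exp_dd e f = exp_dd r s * (exp u - exp_dd u v * u + exp_dd u v * l)"
    unfolding matrix_exp_2_alt[OF a] matrix_exp_2_alt[OF b] matrix_exp_2_alt[OF c]
    using affine_product_factor nz by metis
  define P Q where "P = a - mat k" and "Q = b - mat l"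
  have "P ** Q = Q ** P"
  proof (cases "m = 0 \<and> P \<noteq> 0 \<and> Q \<noteq> 0")
    case False
    then show ?thesis
      using commute_if_mult_eq_mat[of P Q m] PQ by (auto simp: P_def Q_def mat2_simps)
  next
    case True
    then have PQ0: "P ** Q = 0" using PQ by (simp add: P_def Q_def mat2_simps)
    then have det: "det P = 0" "det Q = 0" using det_eq_0_if_mult_eq_0 True by auto
    obtain r2 where r2: "char_roots a k r2" "exp_dd k r2 = exp_dd r s"
      "exp r - exp_dd r s * r + exp_dd r s * k = exp k"
      using char_roots_with_root[OF a] det(1) unfolding P_def by blast
    obtain s1 where s1: "char_roots b l s1" "exp_dd l s1 = exp_dd u v"
      "exp u - exp_dd u v * u + exp_dd u v * l = exp l"
      using char_roots_with_root[OF b] det(2) unfolding Q_def by blast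
    have b': "char_roots b s1 l" using s1 char_roots_commute by blast
    have c': "char_roots (a + b) (k + s1) (r2 + l)"
      using char_roots_add[OF _ r2(1) b'] PQ0 by (simp add: P_def Q_def)
    have dd: "exp_dd (k + s1) (r2 + l) = exp_dd e f"
      using char_roots_unique[OF c c'] exp_dd_commute by metis
    \<comment> \<open>The scalar factor in the equation for \<open>k\<close> is now
      \<open>exp k\<close>, which shifts the divided difference at \<open>s1\<close>,
      \<open>l\<close> by \<open>k\<close>.\<close>
    have "exp_dd (k + s1) (k + l) = exp_dd e f"
      using k r2 s1 by (simp add: exp_dd_shift exp_dd_commute mult.commute)
    moreover have "exp_dd (k + l) (r2 + l) = exp_dd e f"
      using l r2 s1 exp_dd_shift[of l k r2] by (simp add: add.commute mult.commute)
    \<comment> \<open>The strips of \<open>b\<close>, \<open>a\<close> and \<open>a + b\<close>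
      bound the three differences of imaginary parts, in this order.\<close>
    ultimately have "k + s1 = k + l \<and> k + l = r2 + l"
      using strip in_strip_iff[OF r2(1)] in_strip_iff[OF b'] in_strip_iff[OF c']
      by (intro exp_dd_all_equal[OF _ _ dd]) auto
    then have "trace P = 0" "trace Q = 0"
      using r2(1) s1(1) by (auto simp: P_def Q_def trace_sub char_roots_def)
         (simp_all add: mat2_simps)
    then show ?thesis using commute_if_mult_eq_0 PQ0 by metis
  qed
  then show ?thesis by (simp add: P_def Q_def mat_diff_commute_iff)
qed

theorem theorem1:
  fixes x y :: "complex ^ 2 ^ 2"
  assumes "\<And>z. eigenvalue x z \<Longrightarrow> z \<notin> \<real>\<^sub>\<le>\<^sub>0"
    and "\<And>z. eigenvalue y z \<Longrightarrow> z \<notin> \<real>\<^sub>\<le>\<^sub>0"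
    and "\<And>z. eigenvalue (x ** y) z \<Longrightarrow> z \<notin> \<real>\<^sub>\<le>\<^sub>0"
    and "matrix_log (x ** y) = matrix_log x + matrix_log y"
  shows "x ** y = y ** x"
proof -
  define a b where "a = matrix_log x" and "b = matrix_log y"
  have a: "matrix_exp a = x" "in_strip a"
    using matrix_log[OF assms(1)] by (auto simp: a_def)
  have b: "matrix_exp b = y" "in_strip b"
    using matrix_log[OF assms(2)] by (auto simp: b_def)
  have c: "matrix_exp (a + b) = x ** y" "in_strip (a + b)"
    using matrix_log[of "x ** y"] assms(3,4) by (simp_all add: a_def b_def)
  have ab: "a ** b = b ** a"
    using matrix_exp_add_imp_commute[of a b] a b c by simp
  obtain r s where rs: "char_roots a r s" using char_roots_exist .
  obtain u v where uv: "char_roots b u v" using char_roots_exist .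
  have "matrix_exp a ** matrix_exp b = matrix_exp b ** matrix_exp a"
    unfolding matrix_exp_2_alt[OF rs] matrix_exp_2_alt[OF uv]
    using ab by (simp add: mat2_simps) algebra
  then show ?thesis using a b by simp
qed

end
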